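(* Let $X,Y$ be real Banach spaces and let $F:\mathcal{D}(F)\subseteq X\to Y$, $\Omega:\mathcal{D}(\Omega)\subseteq X\to[0,\infty)$, $\mathcal{D}=\mathcal{D}(F)\cap\mathcal{D}(\Omega)$, $\psi:[0,\infty)\to[0,\infty)$, $y\in F(\mathcal{D}(F))$, $x^\dagger\in\mathcal{D}$ and $\xi=\Omega'(x^\dagger)\in X^*$ satisfy the standing assumptions (A1)-(A6) and (B1)-(B3) listed in the context. Let $\alpha_{\max}>0$ and $\rho:=\alpha_{\max}(1+\Omega(x^\dagger))$. Suppose that $\xi$ satisfies the canonical source condition $$\xi=F'(x^\dagger)^*w\quad\text{for some } w\in Y^*,$$ and that for some index function $\sigma$ and some constant $C>0$ the structural condition $$\|F'(x^\dagger)(x-x^\dagger)\|_Y\le C\,\sigma(\|F(x)-F(x^\dagger)\|_Y)\qquad\text{for all }x\in\mathcal{M}_{\alpha_{\max}}(\rho)$$ holds. Then there exist multipliers $0\le\beta_1<1$ and $\beta_2>0$ such that the variational inequality $$\langle \xi,x^\dagger-x\rangle_{X^*,X}\le \beta_1 D_\xi(x,x^\dagger)+\beta_2\,\varphi(\|F(x)-F(x^\dagger)\|_Y)\qquad\text{for all }x\in\mathcal{M}_{\alpha_{\max}}(\rho)$$ holds with the index function $\varphi=\sigma$.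
   Context: Index function: a continuous, strictly increasing function $\eta:[0,\infty)\to[0,\infty)$ with $\eta(0)=0$; restrictions of such functions to a segment $[0,\overline a]$, $0<\overline a<\infty$, are also called index functions (if $\sigma$ is only defined on a segment, it is understood that the arguments at which it is evaluated lie in that segment). Setting: the equation $F(x)=y$ is considered, with exact right-hand side $y\in F(\mathcal{D}(F))$. For $\alpha>0$ put $T^0_\alpha(x)=\psi(\|F(x)-y\|_Y)+\alpha\Omega(x)$ and, for $c\ge0$, $\mathcal{M}_\alpha(c):=\{x\in\mathcal{D}: T^0_\alpha(x)\le c\}$. Standing assumptions: (A1) $X,Y$ are real Banach spaces with duals $X^*,Y^*$ and dual pairings $\langle\cdot,\cdot\rangle_{X^*,X}$, $\langle\cdot,\cdot\rangle_{Y^*,Y}$; $\rightharpoonup$ denotes weak convergence. (A2) $F$ is weakly-weakly sequentially continuous and $\mathcal{D}(F)$ is weakly sequentially closed: if $x_k\in\mathcal{D}(F)$ and $x_k\rightharpoonup x$ in $X$, then $x\in\mathcal{D}(F)$ and $F(x_k)\rightharpoonup F(x)$ in $Y$. (A3) $\mathcal{D}(\Omega)$ is convex and $\Omega$ is convex and weakly sequentially lower semi-continuous. (A4) $\mathcal{D}=\mathcal{D}(F)\cap\mathcal{D}(\Omega)\neq\emptyset$. (A5) For every $\alpha>0$ and $c\ge0$, every sequence in $\mathcal{M}_\alpha(c)$ has a subsequence that converges weakly in $X$ to some element of $X$. (A6) $\psi:[0,\infty)\to[0,\infty)$ is an index function and there are constants $a>0$, $b>0$ with $\psi(u+v)\le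 a\psi(u)+b\psi(v)$ for all $u,v\in[0,\infty)$. (B1) $x^\dagger\in\mathcal{D}$ is an $\Omega$-minimizing solution of $F(x)=y$, i.e. $F(x^\dagger)=y$ and $\Omega(x^\dagger)=\min\{\Omega(x):F(x)=y,\ x\in\mathcal{D}\}<\infty$. (B2) $F$ is Gâteaux differentiable at $x^\dagger$ with Gâteaux derivative $F'(x^\dagger)\in\mathcal{L}(X,Y)$ (bounded linear operators); $F'(x^\dagger)^*\in\mathcal{L}(Y^*,X^* )$ is its Banach space adjoint. (B3) $\Omega$ is Gâteaux differentiable at $x^\dagger$ with Gâteaux derivative $\xi=\Omega'(x^\dagger)\in X^*$, so that the subdifferential $\partial\Omega(x^\dagger)=\{\xi\}$ is a singleton. Bregman distance: $D_\xi(x,x^\dagger):=\Omega(x)-\Omega(x^\dagger)-\langle\xi,x-x^\dagger\rangle_{X^*,X}$ for $x\in\mathcal{D}(\Omega)$. *)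

theory Defs
  imports "HOL-Analysis.Analysis"
begin

text \<open>
  The dual of a real Banach space \<open>'a\<close> is \<open>'a \<Rightarrow>\<^sub>L real\<close>, with blinfun application as dual pairing.
  A partial map is a total function together with a set, its domain; its values outside the domain
  are never used.
\<close>

definition weakly_converges_to :: "(nat \<Rightarrow> 'a::real_normed_vector) \<Rightarrow> 'a \<Rightarrow> bool" where
  "weakly_converges_to xs x \<longleftrightarrow>
     (\<forall>f :: 'a \<Rightarrow>\<^sub>L real. (\<lambda>k. blinfun_apply f (xs k)) \<longlonglongrightarrow> blinfun_apply f x)"

definition weakly_seq_lsc_on :: "'a::real_normed_vector set \<Rightarrow> ('a \<Rightarrow> real) \<Rightarrow> bool" where
  "weakly_seq_lsc_on S f \<longleftrightarrow>
     (\<forall>xs x. (\<forall>k. xs k \<in> S) \<and> x \<in> S \<and> weakly_converges_to xs x \<longrightarrow>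
        ereal (f x) \<le> liminf (\<lambda>k. ereal (f (xs k))))"

definition index_function :: "(real \<Rightarrow> real) \<Rightarrow> bool" where
  "index_function \<eta> \<longleftrightarrow>
     \<eta> \<in> {0..} \<rightarrow> {0..} \<and> continuous_on {0..} \<eta> \<and> strict_mono_on {0..} \<eta> \<and> \<eta> 0 = 0"

definition index_function_on :: "real set \<Rightarrow> (real \<Rightarrow> real) \<Rightarrow> bool" where
  "index_function_on S \<eta> \<longleftrightarrow>
     (S = {0..} \<or> (\<exists>a>0. S = {0..a})) \<and>
     (\<exists>g. index_function g \<and> (\<forall>t\<in>S. \<eta> t = g t))"

text \<open>
  The Gateaux derivative of a map with domain \<open>S\<close> at \<open>x\<close>: every line through \<open>x\<close> stays in \<open>S\<close>
  near \<open>x\<close>, and all two-sided directional derivatives exist and are given by the bounded linear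
  map \<open>L\<close>.
\<close>

definition has_gateaux_derivative_at ::
  "('a::real_normed_vector \<Rightarrow> 'b::real_normed_vector) \<Rightarrow> ('a \<Rightarrow>\<^sub>L 'b) \<Rightarrow> 'a set \<Rightarrow> 'a \<Rightarrow> bool" where
  "has_gateaux_derivative_at f L S x \<longleftrightarrow>
     x \<in> S \<and>
     (\<forall>h. (\<forall>\<^sub>F t in at (0::real). x + t *\<^sub>R h \<in> S) \<and>
          ((\<lambda>t. (f (x + t *\<^sub>R h) - f x) /\<^sub>R t) \<longlongrightarrow> blinfun_apply L h) (at 0))"

definition banach_adjoint ::
  "('a::real_normed_vector \<Rightarrow>\<^sub>L 'b::real_normed_vector) \<Rightarrow> ('b \<Rightarrow>\<^sub>L real) \<Rightarrow>\<^sub>L ('a \<Rightarrow>\<^sub>L real)" where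
  "banach_adjoint A = Blinfun (\<lambda>w. w o\<^sub>L A)"

lemma banach_adjoint_apply [simp]: "blinfun_apply (banach_adjoint A) w = w o\<^sub>L A"
  unfolding banach_adjoint_def
  by (rule bounded_linear_Blinfun_apply
        [THEN fun_cong, OF bounded_bilinear.bounded_linear_left[OF bounded_bilinear_blinfun_compose]])

definition bregman_distance ::
  "('a::real_normed_vector \<Rightarrow> real) \<Rightarrow> ('a \<Rightarrow>\<^sub>L real) \<Rightarrow> 'a \<Rightarrow> 'a \<Rightarrow> real" where
  "bregman_distance \<Omega> \<xi> x z = \<Omega> x - \<Omega> z - blinfun_apply \<xi> (x - z)"

definition tikhonov_functional ::
  "(real \<Rightarrow> real) \<Rightarrow> ('a \<Rightarrow> 'b::real_normed_vector) \<Rightarrow> 'b \<Rightarrow> ('a \<Rightarrow> real) \<Rightarrow> real \<Rightarrow> 'a \<Rightarrow> real" where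
  "tikhonov_functional \<psi> F y \<Omega> \<alpha> x = \<psi> (norm (F x - y)) + \<alpha> * \<Omega> x"

definition tikhonov_sublevel ::
  "(real \<Rightarrow> real) \<Rightarrow> ('a \<Rightarrow> 'b::real_normed_vector) \<Rightarrow> 'b \<Rightarrow> ('a \<Rightarrow> real) \<Rightarrow> 'a set \<Rightarrow> real \<Rightarrow> real \<Rightarrow> 'a set"
where
  "tikhonov_sublevel \<psi> F y \<Omega> D \<alpha> c = {x \<in> D. tikhonov_functional \<psi> F y \<Omega> \<alpha> x \<le> c}"

text \<open>
  The subdifferential of a functional that is \<open>\<infinity>\<close> outside \<open>S\<close>. For a convex functional the Gateaux
  derivative is its only element, so this is not a separate assumption.
\<close>

definition subdifferential_on ::
  "'a::real_normed_vector set \<Rightarrow> ('a \<Rightarrow> real) \<Rightarrow> 'a \<Rightarrow> ('a \<Rightarrow>\<^sub>L real) set" where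
  "subdifferential_on S f x = {\<eta>. \<forall>z\<in>S. f x + blinfun_apply \<eta> (z - x) \<le> f z}"

lemma subdifferential_on_eq_gateaux_derivative:
  assumes cvx: "convex_on S f" and gd: "has_gateaux_derivative_at f \<xi> S x"
  shows "subdifferential_on S f x = {\<xi>}"
proof -
  have xS: "x \<in> S"
    and ev: "\<forall>\<^sub>F t in at_right (0::real). x + t *\<^sub>R h \<in> S"
    and lim: "((\<lambda>t. (f (x + t *\<^sub>R h) - f x) /\<^sub>R t) \<longlongrightarrow> blinfun_apply \<xi> h) (at_right 0)" for h
    using gd unfolding has_gateaux_derivative_at_def
    by (auto intro: filterlim_at_split[THEN iffD1, THEN conjunct2] simp: eventually_at_split)
  have pos: "\<forall>\<^sub>F t in at_right (0::real). 0 < t \<and> t < 1"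
    unfolding eventually_at_right[OF zero_less_one] by (rule exI[of _ 1]) simp
  have "\<xi> \<in> subdifferential_on S f x"
  proof -
    have "f x + blinfun_apply \<xi> (z - x) \<le> f z" if z: "z \<in> S" for z
    proof -
      have "\<forall>\<^sub>F t in at_right (0::real). (f (x + t *\<^sub>R (z - x)) - f x) /\<^sub>R t \<le> f z - f x"
        using pos
      proof eventually_elim
        case (elim t)
        have "f ((1 - t) *\<^sub>R x + t *\<^sub>R z) \<le> (1 - t) * f x + t * f z"
          using convex_onD[OF cvx, of t x z] elim xS z by simp
        also have "(1 - t) *\<^sub>R x + t *\<^sub>R z = x + t *\<^sub>R (z - x)"
          by (simp add: algebra_simps)
        finally show ?case using elim by (simp add: field_simps)
      qed
      from tendsto_upperbound[OF lim this] show ?thesis by simp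
    qed
    then show ?thesis by (simp add: subdifferential_on_def)
  qed
  moreover have "\<eta> = \<xi>" if \<eta>: "\<eta> \<in> subdifferential_on S f x" for \<eta>
  proof -
    have le: "blinfun_apply \<eta> h \<le> blinfun_apply \<xi> h" for h
    proof -
      have "\<forall>\<^sub>F t in at_right (0::real). blinfun_apply \<eta> h \<le> (f (x + t *\<^sub>R h) - f x) /\<^sub>R t"
        using pos ev[of h]
      proof eventually_elim
        case (elim t)
        then have "f x + blinfun_apply \<eta> ((x + t *\<^sub>R h) - x) \<le> f (x + t *\<^sub>R h)"
          using \<eta> unfolding subdifferential_on_def by blast
        then show ?case using elim by (simp add: blinfun.scaleR_right field_simps)
      qed
      from tendsto_lowerbound[OF lim this] show ?thesis by simp
    qed
    show ?thesis
    proof (rule blinfun_eqI)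
      show "blinfun_apply \<eta> h = blinfun_apply \<xi> h" for h
        using le[of h] le[of "- h"] by (simp add: blinfun.minus_right)
    qed
  qed
  ultimately show ?thesis by blast
qed

end

theory Submission
  imports Defs
begin

text \<open>
  Under the source condition the left-hand side factors through the derivative:
  \<open>\<langle>\<xi>, x\<dagger> - x\<rangle> = \<langle>w, F'(x\<dagger>)(x\<dagger> - x)\<rangle>\<close>. It is therefore controlled by
  \<open>\<parallel>w\<parallel> \<parallel>F'(x\<dagger>)(x - x\<dagger>)\<parallel>\<close>, which is the very quantity that the structural condition
  estimates by \<open>C \<sigma>(\<parallel>F(x) - F(x\<dagger>)\<parallel>)\<close>. No share of the Bregman distance has to be spent, so
  \<open>\<beta>\<^sub>1 = 0\<close> works.
\<close>

lemma banach_adjoint_pairing_le: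
  "blinfun_apply (blinfun_apply (banach_adjoint A) w) h \<le> norm w * norm (blinfun_apply A h)"
  using norm_blinfun[of w "blinfun_apply A h"] by simp

theorem theorem1:
  fixes F :: "'a::banach \<Rightarrow> 'b::banach"
    and DF D\<Omega> D :: "'a set"
    and \<Omega> :: "'a \<Rightarrow> real"
    and \<psi> \<sigma> :: "real \<Rightarrow> real"
    and I\<sigma> :: "real set"
    and y :: 'b
    and xdag :: 'a
    and F' :: "'a \<Rightarrow>\<^sub>L 'b"
    and \<xi> :: "'a \<Rightarrow>\<^sub>L real"
    and \<alpha>max \<rho> C :: real
  assumes D: "D = DF \<inter> D\<Omega>"
    and \<Omega>_nonneg: "\<forall>x\<in>D\<Omega>. 0 \<le> \<Omega> x"
    and y: "y \<in> F ` DF"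
    and A2: "\<forall>xs x. (\<forall>k. xs k \<in> DF) \<and> weakly_converges_to xs x \<longrightarrow>
               x \<in> DF \<and> weakly_converges_to (\<lambda>k. F (xs k)) (F x)"
    and A3: "convex D\<Omega>" "convex_on D\<Omega> \<Omega>" "weakly_seq_lsc_on D\<Omega> \<Omega>"
    and A4: "D \<noteq> {}"
    and A5: "\<forall>\<alpha>>0. \<forall>c\<ge>0. \<forall>xs :: nat \<Rightarrow> 'a. (\<forall>k. xs k \<in> tikhonov_sublevel \<psi> F y \<Omega> D \<alpha> c) \<longrightarrow>
               (\<exists>(r :: nat \<Rightarrow> nat) x. strict_mono r \<and> weakly_converges_to (xs \<circ> r) x)"
    and A6: "index_function \<psi>"
            "\<exists>a>0. \<exists>b>0. \<forall>u\<ge>0. \<forall>v\<ge>0. \<psi> (u + v) \<le> a * \<psi> u + b * \<psi> v"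
    and B1: "is_arg_min \<Omega> (\<lambda>x. x \<in> D \<and> F x = y) xdag"
    and B2: "has_gateaux_derivative_at F F' DF xdag"
    and B3: "has_gateaux_derivative_at \<Omega> \<xi> D\<Omega> xdag"
    and \<alpha>max: "\<alpha>max > 0"
    and \<rho>: "\<rho> = \<alpha>max * (1 + \<Omega> xdag)"
    and source: "\<exists>w. \<xi> = blinfun_apply (banach_adjoint F') w"
    and \<sigma>: "index_function_on I\<sigma> \<sigma>"
           "\<forall>x \<in> tikhonov_sublevel \<psi> F y \<Omega> D \<alpha>max \<rho>. norm (F x - F xdag) \<in> I\<sigma>"
    and C: "C > 0"
    and structural: "\<forall>x \<in> tikhonov_sublevel \<psi> F y \<Omega> D \<alpha>max \<rho>.
           norm (blinfun_apply F' (x - xdag)) \<le> C * \<sigma> (norm (F x - F xdag))"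
  shows "\<exists>\<beta>1 \<beta>2. 0 \<le> \<beta>1 \<and> \<beta>1 < 1 \<and> \<beta>2 > 0 \<and>
           (\<forall>x \<in> tikhonov_sublevel \<psi> F y \<Omega> D \<alpha>max \<rho>.
              blinfun_apply \<xi> (xdag - x) \<le>
                \<beta>1 * bregman_distance \<Omega> \<xi> x xdag + \<beta>2 * \<sigma> (norm (F x - F xdag)))"
proof -
  obtain w where w: "\<xi> = blinfun_apply (banach_adjoint F') w"
    using source by blast
  (* norm w alone would give the multiplier 0 when w = 0, but beta2 must be positive *)
  let ?\<beta> = "(norm w + 1) * C"
  have "blinfun_apply \<xi> (xdag - x) \<le> ?\<beta> * \<sigma> (norm (F x - F xdag))"
    if x: "x \<in> tikhonov_sublevel \<psi> F y \<Omega> D \<alpha>max \<rho>" for x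
  proof -
    have "blinfun_apply \<xi> (xdag - x) \<le> norm w * norm (blinfun_apply F' (xdag - x))"
      unfolding w by (rule banach_adjoint_pairing_le)
    also have "norm (blinfun_apply F' (xdag - x)) = norm (blinfun_apply F' (x - xdag))"
      by (simp add: blinfun.diff_right norm_minus_commute)
    also have "norm w * norm (blinfun_apply F' (x - xdag))
        \<le> (norm w + 1) * norm (blinfun_apply F' (x - xdag))"
      by (intro mult_right_mono) auto
    also have "\<dots> \<le> (norm w + 1) * (C * \<sigma> (norm (F x - F xdag)))"
      using structural x by (intro mult_left_mono) auto
    finally show ?thesis by (simp add: mult.assoc)
  qed
  moreover have "?\<beta> > 0"
    using C by (simp add: add_nonneg_pos)
  ultimately show ?thesis
    by (intro exI[of _ 0] exI[of _ ?\<beta>]) auto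
qed

end
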